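(* Suppose that the mirror map $\chi$ satisfies Assumptions 1 and 2 stated in the context, and that the coefficients $\{\gamma_k\}_{k=0}^\infty$, with $\gamma_0=1$ and $\gamma_k\ge1$, satisfy $$\gamma_k^2-\gamma_{k-1}^2-\gamma_k\le0,\qquad k=1,2,\dots$$ Assume that $f$ is $L_f$-smooth, i.e. $\|\nabla f(x)-\nabla f(y)\|_\star\le L_f\|x-y\|$ for all $x,y$ in the domain of $f$, and that the learning rate $h>0$ satisfies $$h\le\frac1{L_fL_\chi}.$$ Let $x^\star$ be a minimizer of $f$ over $\mathcal{X}$, and define for $k=0,1,\dots$ $$\widehat V_k(x_k,\zeta_k)=(\gamma_k^2-\gamma_k)h\big(f(x_k)-f(x^\star)\big)+D_\phi\big(x^\star,\chi(\zeta_k)\big).$$ Then, for $(x_{k+1},\zeta_{k+1})$ given by the AMD algorithm, $$\widehat V_{k+1}(x_{k+1},\zeta_{k+1})\le\widehat V_k(x_k,\zeta_k),\qquad k=0,1,\dots$$ and therefore $$(\gamma_k^2-\gamma_k)h\big(f(x_k)-f(x^\star)\big)\le D_\phi\big(x^\star,\chi(\zeta_0)\big),\qquad k=0,1,\dots$$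
   Context: $\mathbb{E}$ denotes $\mathbb{R}^d$ with an arbitrary norm $\|\cdot\|$, $\mathbb{E}^\star$ is its dual with dual norm $\|\cdot\|_\star$, and $\langle\zeta,x\rangle=\sum_j\zeta_jx_j$ is the pairing between $\zeta\in\mathbb{E}^\star$ and $x\in\mathbb{E}$. The set $\mathcal{X}\subseteq\mathbb{R}^d$ is non-empty, closed and convex, with relative interior $\mathrm{ri}(\mathcal{X})$ and indicator function $\delta_{\mathcal{X}}$ ($0$ on $\mathcal{X}$, $\infty$ elsewhere); $f$ is a real-valued function that is convex and continuously differentiable in an open set containing $\mathcal{X}$; $\nabla f(x)\in\mathbb{E}^\star$. Assumption 1: $\chi=\nabla\psi^\star$ for some convex and differentiable $\psi^\star:\mathbb{E}^\star\to\mathbb{R}$, $\chi$ takes values in $\mathcal{X}$, and $\|\chi(\xi)-\chi(\zeta)\|\le L_\chi\|\xi-\zeta\|_\star$ for all $\xi,\zeta\in\mathbb{E}^\star$. Assumption 2: $\chi=\nabla\psi^\star$ is differentiable and its image is $\mathrm{ri}(\mathcal{X})$. In addition, $\psi^\star$ is the convex conjugate of $\psi=\phi+\delta_{\mathcal{X}}$ (i.e. $\psi^\star(\zeta)=\sup_{x\in\mathbb{E}}\{\langle\zeta,x\rangle-\psi(x)\}$), where $\phi:\mathbb{E}\to(-\infty,\infty]$ is proper, convex, differentiable over $\mathrm{ri}(\mathcal{X})$ and satisfies $\mathcal{X}\subseteq\mathrm{dom}(\phi)$. Primal Bregman divergence: for $x\in\mathcal{X}$, $z\in\mathrm{ri}(\mathcal{X})$,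 $D_\phi(x,z)=\phi(x)-\phi(z)-\langle\nabla\phi(z),x-z\rangle$. AMD (Accelerated Mirror Descent): given $h>0$, $\{\gamma_k\}$, $x_0\in\mathcal{X}$, $\zeta_0\in\mathbb{E}^\star$, for $k=0,1,\dots$: $$y_k=x_k+\tfrac1{\gamma_k}(\chi(\zeta_k)-x_k),\quad \zeta_{k+1}=\zeta_k-\gamma_k h\nabla f(y_k),\quad x_{k+1}=y_k+\tfrac1{\gamma_k}\big(\chi(\zeta_{k+1})-\chi(\zeta_k)\big).$$ *)

theory Defs
  imports "HOL-Analysis.Analysis"
begin

(* The space E is real ^ 'n with an arbitrary norm N (not the built-in Euclidean norm).
   Its dual is identified with real ^ 'n through the pairing inner z x = (SUM j. z $ j * x $ j). *)

definition is_norm :: "(real ^ 'n \<Rightarrow> real) \<Rightarrow> bool" where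
  "is_norm N \<longleftrightarrow>
     (\<forall>x. 0 \<le> N x) \<and> (\<forall>x. N x = 0 \<longleftrightarrow> x = 0) \<and>
     (\<forall>a x. N (a *\<^sub>R x) = \<bar>a\<bar> * N x) \<and> (\<forall>x y. N (x + y) \<le> N x + N y)"

(* The supremum is over a non-empty set, bounded above because norms on real ^ 'n are equivalent. *)
definition dual_norm :: "(real ^ 'n \<Rightarrow> real) \<Rightarrow> real ^ 'n \<Rightarrow> real" where
  "dual_norm N \<zeta> = (SUP x \<in> {x. N x \<le> 1}. \<zeta> \<bullet> x)"

(* Meaningful only at points where g is differentiable. *)
definition gradient :: "(real ^ 'n \<Rightarrow> real) \<Rightarrow> real ^ 'n \<Rightarrow> real ^ 'n" where
  "gradient g x = (THE D. GDERIV g x :> D)"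

definition ext_proper :: "(real ^ 'n \<Rightarrow> ereal) \<Rightarrow> bool" where
  "ext_proper \<phi> \<longleftrightarrow> (\<forall>x. \<phi> x \<noteq> -\<infinity>) \<and> (\<exists>x. \<phi> x \<noteq> \<infinity>)"

(* Only used for functions that avoid -\<infinity>, so the right-hand side is never \<infinity> - \<infinity>. *)
definition ext_convex :: "(real ^ 'n \<Rightarrow> ereal) \<Rightarrow> bool" where
  "ext_convex \<phi> \<longleftrightarrow>
     (\<forall>x y t. 0 < t \<and> t < 1 \<longrightarrow>
        \<phi> ((1 - t) *\<^sub>R x + t *\<^sub>R y) \<le> ereal (1 - t) * \<phi> x + ereal t * \<phi> y)"

definition ext_dom :: "(real ^ 'n \<Rightarrow> ereal) \<Rightarrow> (real ^ 'n) set" where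
  "ext_dom \<phi> = {x. \<phi> x < \<infinity>}"

(* Finiteness near z must be required separately, since real_of_ereal sends infinite values to 0. *)
definition ext_differentiable_at :: "(real ^ 'n \<Rightarrow> ereal) \<Rightarrow> real ^ 'n \<Rightarrow> bool" where
  "ext_differentiable_at \<phi> z \<longleftrightarrow>
     (\<forall>\<^sub>F x in nhds z. \<bar>\<phi> x\<bar> \<noteq> \<infinity>) \<and> (\<lambda>x. real_of_ereal (\<phi> x)) differentiable (at z)"

definition indicator_fun :: "(real ^ 'n) set \<Rightarrow> real ^ 'n \<Rightarrow> ereal" where
  "indicator_fun X x = (if x \<in> X then 0 else \<infinity>)"

definition convex_conjugate :: "(real ^ 'n \<Rightarrow> ereal) \<Rightarrow> real ^ 'n \<Rightarrow> ereal" where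
  "convex_conjugate \<psi> \<zeta> = (SUP x. ereal (\<zeta> \<bullet> x) - \<psi> x)"

(* Real-valued because it is only used for x in X and z in rel_interior X, where \<phi> is finite. *)
definition bregman :: "(real ^ 'n \<Rightarrow> ereal) \<Rightarrow> real ^ 'n \<Rightarrow> real ^ 'n \<Rightarrow> real" where
  "bregman \<phi> x z =
     real_of_ereal (\<phi> x) - real_of_ereal (\<phi> z)
       - gradient (\<lambda>u. real_of_ereal (\<phi> u)) z \<bullet> (x - z)"

(* The mirror map is called mir because the letter chi is the vector binder of HOL-Analysis. *)
definition mirror_assumption1 ::
  "(real ^ 'n \<Rightarrow> real) \<Rightarrow> (real ^ 'n) set \<Rightarrow> real \<Rightarrow>
   (real ^ 'n \<Rightarrow> real ^ 'n) \<Rightarrow> (real ^ 'n \<Rightarrow> real) \<Rightarrow> bool" where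
  "mirror_assumption1 N X L mir \<psi>star \<longleftrightarrow>
     convex_on UNIV \<psi>star \<and>
     (\<forall>\<zeta>. \<psi>star differentiable (at \<zeta>)) \<and>
     (\<forall>\<zeta>. mir \<zeta> = gradient \<psi>star \<zeta>) \<and>
     range mir \<subseteq> X \<and>
     (\<forall>\<xi> \<zeta>. N (mir \<xi> - mir \<zeta>) \<le> L * dual_norm N (\<xi> - \<zeta>))"

definition mirror_assumption2 ::
  "(real ^ 'n) set \<Rightarrow> (real ^ 'n \<Rightarrow> real ^ 'n) \<Rightarrow> (real ^ 'n \<Rightarrow> real) \<Rightarrow>
   (real ^ 'n \<Rightarrow> ereal) \<Rightarrow> bool" where
  "mirror_assumption2 X mir \<psi>star \<phi> \<longleftrightarrow>
     (\<forall>\<zeta>. mir differentiable (at \<zeta>)) \<and>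
     range mir = rel_interior X \<and>
     (\<forall>\<zeta>. ereal (\<psi>star \<zeta>) = convex_conjugate (\<lambda>x. \<phi> x + indicator_fun X x) \<zeta>) \<and>
     ext_proper \<phi> \<and> ext_convex \<phi> \<and>
     (\<forall>z \<in> rel_interior X. ext_differentiable_at \<phi> z) \<and>
     X \<subseteq> ext_dom \<phi>"

definition convex_C1_on :: "(real ^ 'n) set \<Rightarrow> (real ^ 'n \<Rightarrow> real) \<Rightarrow> bool" where
  "convex_C1_on U f \<longleftrightarrow>
     convex_on U f \<and> (\<forall>x\<in>U. f differentiable (at x)) \<and> continuous_on U (gradient f)"

definition smooth_wrt ::
  "(real ^ 'n \<Rightarrow> real) \<Rightarrow> real \<Rightarrow> (real ^ 'n) set \<Rightarrow> (real ^ 'n \<Rightarrow> real) \<Rightarrow> bool" where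
  "smooth_wrt N L U f \<longleftrightarrow>
     (\<forall>x\<in>U. \<forall>y\<in>U. dual_norm N (gradient f x - gradient f y) \<le> L * N (x - y))"

definition amd ::
  "(real ^ 'n) set \<Rightarrow> (real ^ 'n \<Rightarrow> real) \<Rightarrow> (real ^ 'n \<Rightarrow> real ^ 'n) \<Rightarrow>
   (nat \<Rightarrow> real) \<Rightarrow> real \<Rightarrow>
   (nat \<Rightarrow> real ^ 'n) \<Rightarrow> (nat \<Rightarrow> real ^ 'n) \<Rightarrow> (nat \<Rightarrow> real ^ 'n) \<Rightarrow> bool" where
  "amd X f mir \<gamma> h x y \<zeta> \<longleftrightarrow>
     x 0 \<in> X \<and>
     (\<forall>k. y k = x k + (1 / \<gamma> k) *\<^sub>R (mir (\<zeta> k) - x k) \<and>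
          \<zeta> (Suc k) = \<zeta> k - (\<gamma> k * h) *\<^sub>R gradient f (y k) \<and>
          x (Suc k) = y k + (1 / \<gamma> k) *\<^sub>R (mir (\<zeta> (Suc k)) - mir (\<zeta> k)))"

definition Vhat ::
  "(real ^ 'n \<Rightarrow> real) \<Rightarrow> (real ^ 'n \<Rightarrow> ereal) \<Rightarrow> (real ^ 'n \<Rightarrow> real ^ 'n) \<Rightarrow>
   (nat \<Rightarrow> real) \<Rightarrow> real \<Rightarrow> real ^ 'n \<Rightarrow> nat \<Rightarrow> real ^ 'n \<Rightarrow> real ^ 'n \<Rightarrow> real" where
  "Vhat f \<phi> mir \<gamma> h xstar k u \<xi> =
     ((\<gamma> k)\<^sup>2 - \<gamma> k) * h * (f u - f xstar) + bregman \<phi> xstar (mir \<xi>)"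

end

theory Submission
  imports Defs
begin

text \<open>
  The divergence \<open>D(xstar, mir \<zeta>)\<close> is controlled through the conjugate \<open>\<psi>star\<close>. The point \<open>mir \<zeta>\<close>
  maximizes \<open>\<lambda>u. \<zeta> \<bullet> u - \<phi> u\<close> over \<open>X\<close> and lies in the relative interior of \<open>X\<close>, so the gradient of
  \<open>\<phi>\<close> at \<open>mir \<zeta>\<close> agrees with \<open>\<zeta>\<close> on the directions of \<open>X\<close>, and
  \<open>D(xstar, mir \<zeta>) = \<phi> xstar + \<psi>star \<zeta> - \<zeta> \<bullet> xstar\<close> (\<open>bregman_mirror\<close>, which rests on
  \<open>fenchel_equality_mirror\<close>). Since the gradient \<open>mir\<close> of \<open>\<psi>star\<close> is Lipschitz with constant \<open>L\<^sub>m\<close>,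
  the function \<open>\<psi>star\<close> lies above its tangents by a quadratic
  (\<open>convex_Lipschitz_gradient_lower_bound\<close>), and a step from \<open>\<zeta>\<close> to \<open>\<zeta>'\<close> changes the divergence by at
  most \<open>(\<zeta>' - \<zeta>) \<bullet> (mir \<zeta>' - xstar) - (N (mir \<zeta>' - mir \<zeta>))\<^sup>2 / (2 * L\<^sub>m)\<close> (\<open>bregman_mirror_step\<close>).

  On the primal side, convexity of \<open>f\<close> at \<open>x k\<close> and at \<open>xstar\<close>, together with smoothness between
  \<open>y k\<close> and \<open>x (Suc k)\<close>, bounds the change of the weighted function values by the linear term
  \<open>\<gamma> k * (\<nabla>f (y k) \<bullet> (mir \<zeta>' - xstar))\<close> plus \<open>L\<^sub>f / 2 * (N (mir \<zeta>' - mir \<zeta>))\<^sup>2\<close>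
  (\<open>accelerated_function_decrease\<close>). The dual update \<open>\<zeta>' - \<zeta> = - \<gamma> k * h * \<nabla>f (y k)\<close> makes the two
  linear terms cancel once this bound is multiplied by \<open>h\<close>, and \<open>h * L\<^sub>f \<le> 1 / L\<^sub>m\<close> makes the negative quadratic dominate the positive one.
  This decrease has the weight \<open>(\<gamma> k)\<^sup>2\<close> on the new function value; the recursion for \<open>\<gamma>\<close> says that
  this is at least the weight \<open>(\<gamma> (Suc k))\<^sup>2 - \<gamma> (Suc k)\<close> in the Lyapunov function. At \<open>k = 0\<close> the
  weight vanishes, and the divergence is nonnegative, which gives the rate.
\<close>

section \<open>Gradients along segments\<close>

lemma gradient_eq:
  assumes "GDERIV g x :> D"
  shows "gradient g x = D"
  unfolding gradient_def
proof (rule the_equality)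
  show "GDERIV g x :> D"
    by (rule assms)
  fix E assume "GDERIV g x :> E"
  then have "(\<lambda>h. h \<bullet> E) = (\<lambda>h. h \<bullet> D)"
    using assms unfolding gderiv_def by (rule has_derivative_unique)
  then have "\<forall>h. h \<bullet> E = h \<bullet> D"
    by (simp add: fun_eq_iff)
  then show "E = D"
    by (simp only: vector_eq_ldot)
qed

lemma GDERIV_gradient:
  assumes "g differentiable (at x)"
  shows "GDERIV g x :> gradient g x"
proof -
  obtain g' where g': "(g has_derivative g') (at x)"
    using assms by (auto simp: differentiable_def)
  have "g' = (\<lambda>h. h \<bullet> adjoint g' 1)"
    using adjoint_works[OF has_derivative_linear[OF g']] by fastforce
  with g' have "GDERIV g x :> adjoint g' 1"
    by (simp add: gderiv_def)
  then show ?thesis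
    by (simp add: gradient_eq)
qed

lemma GDERIV_along_line:
  fixes v :: "real ^ 'n"
  assumes "GDERIV g (x + t *\<^sub>R v) :> D"
  shows "((\<lambda>s. g (x + s *\<^sub>R v)) has_real_derivative D \<bullet> v) (at t)"
proof -
  have "((\<lambda>s. x + s *\<^sub>R v) has_derivative (\<lambda>s. s *\<^sub>R v)) (at t)"
    by (auto intro!: derivative_eq_intros)
  then have "((\<lambda>s. g (x + s *\<^sub>R v)) has_derivative (\<lambda>s. (s *\<^sub>R v) \<bullet> D)) (at t)"
    using assms unfolding gderiv_def by (rule has_derivative_compose)
  moreover have "(\<lambda>s. (s *\<^sub>R v) \<bullet> D) = (*) (D \<bullet> v)"
    by (rule ext) (simp add: inner_commute[of v])
  ultimately show ?thesis
    by (simp only: has_field_derivative_def)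
qed

text \<open>Only the values on the segment from \<open>x\<close> to \<open>u\<close> are compared, so the lemma applies both to real
  convex functions and to the finite part of an extended-valued one.\<close>

lemma tangent_below_chord:
  fixes x u :: "real ^ 'n"
  assumes D: "GDERIV g x :> D"
    and chord: "\<And>t. 0 < t \<Longrightarrow> t < 1 \<Longrightarrow> g ((1 - t) *\<^sub>R x + t *\<^sub>R u) \<le> (1 - t) * g x + t * g u"
  shows "g x + D \<bullet> (u - x) \<le> g u"
proof (rule ccontr)
  assume "\<not> ?thesis"
  then have pos: "D \<bullet> (u - x) - (g u - g x) > 0"
    by simp
  let ?q = "\<lambda>s. g (x + s *\<^sub>R (u - x)) - s * (g u - g x)"
  have "((\<lambda>s. g (x + s *\<^sub>R (u - x))) has_real_derivative D \<bullet> (u - x)) (at 0)"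
    using D by (intro GDERIV_along_line) simp
  then have "(?q has_real_derivative D \<bullet> (u - x) - (g u - g x)) (at 0)"
    by (auto intro!: derivative_eq_intros)
  from DERIV_pos_inc_right[OF this pos] obtain d where d: "d > 0" "\<And>s. s > 0 \<Longrightarrow> s < d \<Longrightarrow> ?q 0 < ?q s"
    by auto
  define s where "s = min (d / 2) (1 / 2)"
  have s: "0 < s" "s < d" "s < 1"
    using d(1) by (auto simp: s_def)
  have eq: "(1 - s) *\<^sub>R x + s *\<^sub>R u = x + s *\<^sub>R (u - x)"
    by (simp add: algebra_simps)
  have "g x < g (x + s *\<^sub>R (u - x)) - s * (g u - g x)"
    using d(2)[OF s(1,2)] by simp
  with chord[OF s(1,3)] show False
    by (simp add: eq algebra_simps)
qed

lemma tangent_below_convex_on: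
  fixes x u :: "real ^ 'n"
  assumes "convex_on U g" and "x \<in> U" and "u \<in> U" and "GDERIV g x :> D"
  shows "g x + D \<bullet> (u - x) \<le> g u"
proof (rule tangent_below_chord[OF assms(4)])
  fix t :: real assume "0 < t" "t < 1"
  then show "g ((1 - t) *\<^sub>R x + t *\<^sub>R u) \<le> (1 - t) * g x + t * g u"
    using convex_onD[OF assms(1), of t x u] assms(2,3) by simp
qed

text \<open>This is the quadratic upper bound of a smooth function, with the Lipschitz condition stated as a
  bound on the directional derivative along one segment. No norm appears in it because \<open>f\<close> lives on
  the primal space and \<open>\<psi>star\<close> on the dual space, so that the two norms change roles between its two
  uses.\<close>

lemma descent_on_segment:
  fixes x v :: "real ^ 'n"
  assumes G: "\<And>t. 0 \<le> t \<Longrightarrow> t \<le> 1 \<Longrightarrow> GDERIV g (x + t *\<^sub>R v) :> G (x + t *\<^sub>R v)"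
    and growth: "\<And>t. 0 \<le> t \<Longrightarrow> t \<le> 1 \<Longrightarrow> (G (x + t *\<^sub>R v) - G x) \<bullet> v \<le> t * K"
  shows "g (x + v) \<le> g x + G x \<bullet> v + K / 2"
proof -
  let ?q = "\<lambda>t. g (x + t *\<^sub>R v) - t * (G x \<bullet> v) - t\<^sup>2 * K / 2"
  have "?q 1 \<le> ?q 0"
  proof (rule DERIV_nonpos_imp_nonincreasing[of 0 1])
    fix t :: real assume t: "0 \<le> t" "t \<le> 1"
    have "(?q has_real_derivative G (x + t *\<^sub>R v) \<bullet> v - G x \<bullet> v - t * K) (at t)"
      using GDERIV_along_line[OF G[OF t]] by (auto intro!: derivative_eq_intros)
    moreover have "G (x + t *\<^sub>R v) \<bullet> v - G x \<bullet> v - t * K \<le> 0"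
      using growth[OF t] by (simp add: inner_diff_left)
    ultimately show "\<exists>y. (?q has_real_derivative y) (at t) \<and> y \<le> 0"
      by blast
  qed simp
  then show ?thesis
    by simp
qed

text \<open>From a point of the relative interior one can move a little both towards \<open>u\<close> and away from \<open>u\<close>
  without leaving \<open>X\<close>, so the one-sided optimality condition holds with equality.\<close>

lemma gradient_orthogonal_at_rel_interior_min:
  fixes z u :: "real ^ 'n"
  assumes "convex X" and z: "z \<in> rel_interior X" and u: "u \<in> X"
    and D: "GDERIV g z :> D"
    and min: "\<And>w. w \<in> X \<Longrightarrow> g z \<le> g w"
  shows "D \<bullet> (u - z) = 0"
proof -
  have zX: "z \<in> X"
    using z rel_interior_subset by blast
  obtain e where e: "e > 1" and a: "(1 - e) *\<^sub>R u + e *\<^sub>R z \<in> X"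
    using z u convex_rel_interior_iff[OF \<open>convex X\<close>] by blast
  define d where "d = min 1 (e - 1)"
  have "d > 0"
    using e by (simp add: d_def)
  have inX: "z + s *\<^sub>R (u - z) \<in> X" if s: "\<bar>s\<bar> < d" for s
  proof (cases "s \<ge> 0")
    case True
    have "(1 - s) *\<^sub>R z + s *\<^sub>R u \<in> X"
      using True s by (intro convexD_alt[OF \<open>convex X\<close> zX u]) (auto simp: d_def)
    then show ?thesis
      by (simp add: algebra_simps)
  next
    case False
    define r where "r = - s / (e - 1)"
    have r: "0 \<le> r" "r \<le> 1" "r * (e - 1) = - s"
      using False s e by (auto simp: r_def d_def divide_simps)
    have "(1 - r) *\<^sub>R z + r *\<^sub>R ((1 - e) *\<^sub>R u + e *\<^sub>R z) \<in> X"
      by (rule convexD_alt[OF \<open>convex X\<close> zX a r(1,2)])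
    also have "(1 - r) *\<^sub>R z + r *\<^sub>R ((1 - e) *\<^sub>R u + e *\<^sub>R z) = z - (r * (e - 1)) *\<^sub>R (u - z)"
      by (simp add: algebra_simps)
    finally show ?thesis
      by (simp add: r(3))
  qed
  have "((\<lambda>s. g (z + s *\<^sub>R (u - z))) has_real_derivative D \<bullet> (u - z)) (at 0)"
    using D by (intro GDERIV_along_line) simp
  then show ?thesis
    by (rule DERIV_local_min[OF _ \<open>d > 0\<close>]) (use min inX in auto)
qed

section \<open>A norm and its dual\<close>

text \<open>As a convex function, \<open>N\<close> is continuous, so it attains a positive minimum on the Euclidean unit
  sphere. The bound makes the unit ball of \<open>N\<close> bounded, and the dual norm a genuine supremum.\<close>

lemma is_norm_coercive:
  fixes N :: "real ^ 'n \<Rightarrow> real"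
  assumes N: "is_norm N"
  shows "\<exists>m>0. \<forall>x. m * norm x \<le> N x"
proof -
  have "convex_on UNIV N"
  proof (rule convex_onI)
    fix t :: real and x y :: "real ^ 'n"
    assume "0 < t" "t < 1"
    then have "N ((1 - t) *\<^sub>R x) = (1 - t) * N x" "N (t *\<^sub>R y) = t * N y"
      using N by (auto simp: is_norm_def)
    then show "N ((1 - t) *\<^sub>R x + t *\<^sub>R y) \<le> (1 - t) * N x + t * N y"
      using N unfolding is_norm_def by metis
  qed simp
  then have "continuous_on UNIV N"
    by (intro convex_on_continuous) auto
  then have "continuous_on (sphere 0 1) N"
    by (rule continuous_on_subset) simp
  moreover have "axis undefined 1 \<in> (sphere 0 1 :: (real ^ 'n) set)"
    by simp
  ultimately obtain x0 where x0: "x0 \<in> sphere 0 1" "\<And>x. x \<in> sphere 0 1 \<Longrightarrow> N x0 \<le> N x"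
    using continuous_attains_inf[of "sphere 0 1" N] by (metis compact_sphere empty_iff)
  have "N x0 \<noteq> 0"
    using N x0(1) by (auto simp: is_norm_def)
  moreover have "N x0 \<ge> 0"
    using N by (auto simp: is_norm_def)
  moreover have "N x0 * norm x \<le> N x" for x
  proof (cases "x = 0")
    case False
    have "N x0 \<le> N ((1 / norm x) *\<^sub>R x)"
      using False by (intro x0(2)) simp
    also have "\<dots> = N x / norm x"
      using N by (simp add: is_norm_def)
    finally show ?thesis
      using False by (simp add: field_simps)
  qed (use N in \<open>simp add: is_norm_def\<close>)
  ultimately show ?thesis
    by (intro exI[of _ "N x0"]) auto
qed

lemma bdd_above_dual_norm:
  assumes N: "is_norm N"
  shows "bdd_above ((\<lambda>x. \<zeta> \<bullet> x) ` {x. N x \<le> 1})"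
proof -
  obtain m where m: "m > 0" "\<And>x. m * norm x \<le> N x"
    using is_norm_coercive[OF N] by blast
  have "\<zeta> \<bullet> x \<le> norm \<zeta> * (1 / m)" if "N x \<le> 1" for x
  proof -
    have "norm x \<le> 1 / m"
      using m(1) m(2)[of x] that by (simp add: field_simps)
    then have "norm \<zeta> * norm x \<le> norm \<zeta> * (1 / m)"
      by (intro mult_left_mono) auto
    then show ?thesis
      using norm_cauchy_schwarz[of \<zeta> x] by linarith
  qed
  then show ?thesis
    by (intro bdd_aboveI) auto
qed

lemma inner_le_dual_norm:
  assumes N: "is_norm N"
  shows "\<zeta> \<bullet> x \<le> dual_norm N \<zeta> * N x"
proof (cases "x = 0")
  case True
  have "N 0 = 0"
    using N unfolding is_norm_def by blast
  with True show ?thesis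
    by simp
next
  case False
  then have "N x \<noteq> 0" "N x \<ge> 0"
    using N unfolding is_norm_def by blast+
  then have pos: "N x > 0"
    by simp
  have "\<zeta> \<bullet> ((1 / N x) *\<^sub>R x) \<le> dual_norm N \<zeta>"
    unfolding dual_norm_def
    by (rule cSUP_upper[OF _ bdd_above_dual_norm[OF N]]) (use N pos in \<open>simp add: is_norm_def\<close>)
  then show ?thesis
    using pos by (simp add: field_simps)
qed

lemma dual_norm_least:
  assumes N: "is_norm N" and "\<And>x. N x \<le> 1 \<Longrightarrow> \<zeta> \<bullet> x \<le> c"
  shows "dual_norm N \<zeta> \<le> c"
proof -
  have "N 0 = 0"
    using N unfolding is_norm_def by blast
  then have "{x. N x \<le> 1} \<noteq> {}"
    by (metis empty_iff mem_Collect_eq zero_le_one)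
  then show ?thesis
    unfolding dual_norm_def using assms(2) by (intro cSUP_least) auto
qed

lemma dual_norm_nonneg:
  assumes N: "is_norm N"
  shows "0 \<le> dual_norm N \<zeta>"
proof -
  have "N 0 = 0"
    using N unfolding is_norm_def by blast
  have "\<zeta> \<bullet> 0 \<le> dual_norm N \<zeta>"
    unfolding dual_norm_def
    by (rule cSUP_upper[OF _ bdd_above_dual_norm[OF N]]) (simp add: \<open>N 0 = 0\<close>)
  then show ?thesis
    by simp
qed

lemma dual_norm_pos:
  assumes N: "is_norm N" and "\<zeta> \<noteq> 0"
  shows "0 < dual_norm N \<zeta>"
proof -
  have "0 < dual_norm N \<zeta> * N \<zeta>"
    using inner_le_dual_norm[OF N, of \<zeta> \<zeta>] \<open>\<zeta> \<noteq> 0\<close> by (metis inner_gt_zero_iff order_less_le_trans)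
  with dual_norm_nonneg[OF N, of \<zeta>] show ?thesis
    by (metis less_eq_real_def less_irrefl mult_zero_left)
qed

lemma dual_norm_scaleR_le:
  assumes N: "is_norm N"
  shows "dual_norm N (c *\<^sub>R \<zeta>) \<le> \<bar>c\<bar> * dual_norm N \<zeta>"
proof (rule dual_norm_least[OF N])
  fix x assume "N x \<le> 1"
  have "c *\<^sub>R \<zeta> \<bullet> x = \<zeta> \<bullet> (c *\<^sub>R x)"
    by simp
  also have "\<dots> \<le> dual_norm N \<zeta> * N (c *\<^sub>R x)"
    by (rule inner_le_dual_norm[OF N])
  also have "\<dots> = \<bar>c\<bar> * dual_norm N \<zeta> * N x"
    using N by (simp add: is_norm_def)
  also have "\<dots> \<le> \<bar>c\<bar> * dual_norm N \<zeta> * 1"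
    using \<open>N x \<le> 1\<close> dual_norm_nonneg[OF N] by (intro mult_left_mono) auto
  finally show "c *\<^sub>R \<zeta> \<bullet> x \<le> \<bar>c\<bar> * dual_norm N \<zeta>"
    by simp
qed

text \<open>This is the Hahn-Banach theorem in finite dimension: a hyperplane separating \<open>v\<close> from the open
  \<open>N\<close>-ball of radius \<open>N v\<close> gives, after scaling, a functional of dual norm at most 1 that attains
  \<open>N v\<close> at \<open>v\<close>.\<close>

lemma norming_functional:
  fixes v :: "real ^ 'n"
  assumes N: "is_norm N"
  shows "\<exists>d. dual_norm N d \<le> 1 \<and> d \<bullet> v = N v"
proof (cases "v = 0")
  case True
  then show ?thesis
    using N dual_norm_least[OF N, of 0 1] by (intro exI[of _ 0]) (auto simp: is_norm_def)
next
  case False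
  have hom: "N (c *\<^sub>R x) = \<bar>c\<bar> * N x" and tri: "N (x + y) \<le> N x + N y" and "N x \<ge> 0" for c x y
    using N by (auto simp: is_norm_def)
  have "N v \<noteq> 0"
    using N False by (auto simp: is_norm_def)
  with \<open>\<And>x. N x \<ge> 0\<close> have Nv: "N v > 0"
    by (metis less_eq_real_def)
  have "N 0 = 0"
    using N by (auto simp: is_norm_def)
  have "convex {x. N x < N v}"
    unfolding convex_alt
  proof safe
    fix x y and t :: real
    assume xy: "N x < N v" "N y < N v" and t: "0 \<le> t" "t \<le> 1"
    have "N ((1 - t) *\<^sub>R x + t *\<^sub>R y) \<le> (1 - t) * N x + t * N y"
      using tri[of "(1 - t) *\<^sub>R x" "t *\<^sub>R y"] t by (simp add: hom)
    also have "\<dots> < N v"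
      using xy t by (intro convex_bound_lt) auto
    finally show "N ((1 - t) *\<^sub>R x + t *\<^sub>R y) < N v" .
  qed
  moreover have "0 \<in> {x. N x < N v}"
    using \<open>N 0 = 0\<close> Nv by simp
  ultimately obtain a b where "a \<noteq> 0" and ab: "\<And>x. N x < N v \<Longrightarrow> a \<bullet> x \<le> b" "b \<le> a \<bullet> v"
    using separating_hyperplane_sets[of "{x. N x < N v}" "{v}"]
    by (metis (no_types, lifting) convex_singleton disjoint_insert(2) empty_iff inf_bot_right
        insertI1 less_irrefl mem_Collect_eq)
  have sep: "a \<bullet> x \<le> a \<bullet> v" if "N x < N v" for x
    using ab that by fastforce
  have av: "a \<bullet> v > 0"
  proof -
    define t where "t = N v / (2 * (N a + 1))"
    have "t > 0"
      using Nv \<open>\<And>x. N x \<ge> 0\<close>[of a] by (simp add: t_def)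
    moreover have "N (t *\<^sub>R a) < N v"
      using Nv \<open>\<And>x. N x \<ge> 0\<close>[of a] by (simp add: t_def hom field_simps add_nonneg_pos)
    then have "t * (a \<bullet> a) \<le> a \<bullet> v"
      using sep by fastforce
    ultimately show ?thesis
      using \<open>a \<noteq> 0\<close> by (metis inner_gt_zero_iff mult_pos_pos order_less_le_trans)
  qed
  have unit: "N v * (a \<bullet> x) \<le> a \<bullet> v" if "N x \<le> 1" for x
  proof (rule field_le_mult_one_interval)
    fix s :: real assume s: "0 < s" "s < 1"
    have "N ((s * N v) *\<^sub>R x) = s * N v * N x"
      using s Nv by (simp add: hom)
    also have "\<dots> \<le> s * N v * 1"
      using that s Nv by (intro mult_left_mono) auto
    also have "\<dots> < N v"
      using s Nv by simp
    finally have "a \<bullet> ((s * N v) *\<^sub>R x) \<le> a \<bullet> v"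
      by (rule sep)
    then show "s * (N v * (a \<bullet> x)) \<le> a \<bullet> v"
      by (simp add: mult.assoc)
  qed
  let ?d = "(N v / (a \<bullet> v)) *\<^sub>R a"
  have "dual_norm N ?d \<le> 1"
    using unit av by (intro dual_norm_least[OF N]) (simp add: divide_simps)
  moreover have "?d \<bullet> v = N v"
    using av by simp
  ultimately show ?thesis
    by blast
qed

text \<open>Compare \<open>\<psi>\<close> at the point \<open>a + v\<close>, reached from \<open>a\<close> by the step that decreases
  \<open>\<lambda>\<xi>. \<psi> \<xi> - G b \<bullet> \<xi>\<close> by the largest amount that the Lipschitz bound guarantees: its direction is
  opposite to a norming functional of \<open>G a - G b\<close>. The tangent at \<open>b\<close> bounds \<open>\<psi> (a + v)\<close> from below and the descent
  inequality at \<open>a\<close> bounds it from above.\<close>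

lemma convex_Lipschitz_gradient_lower_bound:
  fixes \<psi> :: "real ^ 'n \<Rightarrow> real"
  assumes N: "is_norm N" and conv: "convex_on UNIV \<psi>"
    and G: "\<And>\<xi>. GDERIV \<psi> \<xi> :> G \<xi>"
    and lip: "\<And>\<xi> \<zeta>. N (G \<xi> - G \<zeta>) \<le> L * dual_norm N (\<xi> - \<zeta>)"
    and "L > 0"
  shows "\<psi> b + G b \<bullet> (a - b) + (N (G a - G b))\<^sup>2 / (2 * L) \<le> \<psi> a"
proof -
  define n where "n = N (G a - G b)"
  have "n \<ge> 0"
    using N by (simp add: n_def is_norm_def)
  obtain d where d: "dual_norm N d \<le> 1" "d \<bullet> (G a - G b) = n"
    using norming_functional[OF N] unfolding n_def by blast
  \<comment> \<open>The step length minimizes \<open>L * t\<^sup>2 / 2 - t * n\<close>.\<close>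
  define t where "t = n / L"
  have "t \<ge> 0"
    using \<open>n \<ge> 0\<close> \<open>L > 0\<close> by (simp add: t_def)
  define v where "v = - t *\<^sub>R d"
  have v: "dual_norm N v \<le> t"
  proof -
    have "dual_norm N v \<le> t * dual_norm N d"
      using dual_norm_scaleR_le[OF N, of "- t" d] \<open>t \<ge> 0\<close> by (simp add: v_def)
    also have "\<dots> \<le> t * 1"
      using d(1) \<open>t \<ge> 0\<close> by (rule mult_left_mono)
    finally show ?thesis
      by simp
  qed
  have "\<psi> (a + v) \<le> \<psi> a + G a \<bullet> v + (L * t\<^sup>2) / 2"
  proof (rule descent_on_segment)
    fix s :: real assume s: "0 \<le> s" "s \<le> 1"
    have sv: "dual_norm N (s *\<^sub>R v) \<le> s * t"
      using dual_norm_scaleR_le[OF N, of s v] mult_left_mono[OF v s(1)] s(1) by simp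
    have "(G (a + s *\<^sub>R v) - G a) \<bullet> v \<le> dual_norm N v * N (G (a + s *\<^sub>R v) - G a)"
      using inner_le_dual_norm[OF N, of v "G (a + s *\<^sub>R v) - G a"] by (simp add: inner_commute)
    also have "\<dots> \<le> t * (L * (s * t))"
    proof (rule mult_mono)
      have "N (G (a + s *\<^sub>R v) - G a) \<le> L * dual_norm N (s *\<^sub>R v)"
        using lip[of "a + s *\<^sub>R v" a] by simp
      also have "\<dots> \<le> L * (s * t)"
        using sv \<open>L > 0\<close> by simp
      finally show "N (G (a + s *\<^sub>R v) - G a) \<le> L * (s * t)" .
    qed (use v \<open>t \<ge> 0\<close> N in \<open>auto simp: is_norm_def\<close>)
    finally show "(G (a + s *\<^sub>R v) - G a) \<bullet> v \<le> s * (L * t\<^sup>2)"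
      by (simp add: power2_eq_square mult_ac)
  qed (rule G)
  moreover have "\<psi> b + G b \<bullet> (a + v - b) \<le> \<psi> (a + v)"
    by (rule tangent_below_convex_on[OF conv _ _ G]) simp_all
  ultimately have "\<psi> b + G b \<bullet> (a - b) + (t * (d \<bullet> (G a - G b)) - L * t\<^sup>2 / 2) \<le> \<psi> a"
    by (simp add: v_def algebra_simps inner_commute)
  moreover have "t * (d \<bullet> (G a - G b)) - L * t\<^sup>2 / 2 = n\<^sup>2 / (2 * L)"
    using \<open>L > 0\<close> by (simp add: d(2) t_def power2_eq_square field_simps)
  ultimately show ?thesis
    by (simp add: n_def)
qed

section \<open>Conjugacy and the primal Bregman divergence\<close>

lemma ereal_of_ext_real:
  assumes "ext_proper \<phi>" and "u \<in> ext_dom \<phi>"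
  shows "ereal (real_of_ereal (\<phi> u)) = \<phi> u"
proof -
  have "\<phi> u \<noteq> - \<infinity>" and "\<phi> u \<noteq> \<infinity>"
    using assms by (auto simp: ext_proper_def ext_dom_def)
  then show ?thesis
    by (cases "\<phi> u") auto
qed

lemma tangent_below_ext_convex:
  fixes \<phi> :: "real ^ 'n \<Rightarrow> ereal"
  assumes proper: "ext_proper \<phi>" and conv: "ext_convex \<phi>"
    and z: "z \<in> ext_dom \<phi>" and u: "u \<in> ext_dom \<phi>"
    and diff: "ext_differentiable_at \<phi> z"
  shows "real_of_ereal (\<phi> z) + gradient (\<lambda>u. real_of_ereal (\<phi> u)) z \<bullet> (u - z) \<le> real_of_ereal (\<phi> u)"
proof (rule tangent_below_chord)
  show "GDERIV (\<lambda>u. real_of_ereal (\<phi> u)) z :> gradient (\<lambda>u. real_of_ereal (\<phi> u)) z"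
    using diff by (intro GDERIV_gradient) (simp add: ext_differentiable_at_def)
next
  fix t :: real assume t: "0 < t" "t < 1"
  have "\<phi> ((1 - t) *\<^sub>R z + t *\<^sub>R u) \<le> ereal (1 - t) * \<phi> z + ereal t * \<phi> u"
    using conv t unfolding ext_convex_def by blast
  also have "\<dots> = ereal (1 - t) * ereal (real_of_ereal (\<phi> z)) + ereal t * ereal (real_of_ereal (\<phi> u))"
    by (simp only: ereal_of_ext_real[OF proper z] ereal_of_ext_real[OF proper u])
  finally have le: "\<phi> ((1 - t) *\<^sub>R z + t *\<^sub>R u)
      \<le> ereal ((1 - t) * real_of_ereal (\<phi> z) + t * real_of_ereal (\<phi> u))"
    by simp
  then have "(1 - t) *\<^sub>R z + t *\<^sub>R u \<in> ext_dom \<phi>"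
    by (auto simp: ext_dom_def)
  from ereal_of_ext_real[OF proper this] le
  show "real_of_ereal (\<phi> ((1 - t) *\<^sub>R z + t *\<^sub>R u))
      \<le> (1 - t) * real_of_ereal (\<phi> z) + t * real_of_ereal (\<phi> u)"
    by (metis ereal_less_eq(3))
qed

lemma conjugate_ge:
  assumes proper: "ext_proper \<phi>" and u: "u \<in> X" "X \<subseteq> ext_dom \<phi>"
    and c: "ereal c = convex_conjugate (\<lambda>x. \<phi> x + indicator_fun X x) \<zeta>"
  shows "\<zeta> \<bullet> u - real_of_ereal (\<phi> u) \<le> c"
proof -
  have "ereal (\<zeta> \<bullet> u) - (\<phi> u + indicator_fun X u) \<le> ereal c"
    unfolding c convex_conjugate_def by (rule SUP_upper) simp
  moreover have "\<phi> u + indicator_fun X u = ereal (real_of_ereal (\<phi> u))"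
    using ereal_of_ext_real[OF proper, of u] u by (auto simp: indicator_fun_def)
  ultimately show ?thesis
    by simp
qed

lemma conjugate_le:
  assumes proper: "ext_proper \<phi>" and X: "X \<subseteq> ext_dom \<phi>"
    and c: "ereal c = convex_conjugate (\<lambda>x. \<phi> x + indicator_fun X x) \<zeta>"
    and b: "\<And>u. u \<in> X \<Longrightarrow> \<zeta> \<bullet> u - real_of_ereal (\<phi> u) \<le> b"
  shows "c \<le> b"
proof -
  have "ereal (\<zeta> \<bullet> u) - (\<phi> u + indicator_fun X u) \<le> ereal b" for u
  proof (cases "u \<in> X")
    case True
    then have "\<phi> u + indicator_fun X u = ereal (real_of_ereal (\<phi> u))"
      using ereal_of_ext_real[OF proper, of u] X by (auto simp: indicator_fun_def)
    then show ?thesis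
      using b[OF True] by simp
  next
    case False
    then show ?thesis
      using proper by (simp add: indicator_fun_def ext_proper_def)
  qed
  then have "ereal c \<le> ereal b"
    unfolding c convex_conjugate_def by (rule SUP_least)
  then show ?thesis
    by simp
qed

lemma mirror_map_GDERIV:
  assumes "mirror_assumption1 N X L mir \<psi>star"
  shows "GDERIV \<psi>star \<zeta> :> mir \<zeta>"
proof -
  have "\<psi>star differentiable (at \<zeta>)" and "mir \<zeta> = gradient \<psi>star \<zeta>"
    using assms unfolding mirror_assumption1_def by blast+
  then show ?thesis
    using GDERIV_gradient by metis
qed

text \<open>The inequality that is not the Fenchel-Young inequality would usually be drawn from
  biconjugation. Here \<open>\<phi>\<close> is differentiable at \<open>z = mir \<zeta>\<close>, and its gradient \<open>\<xi>\<close> there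
  satisfies \<open>\<psi>star \<xi> \<le> \<xi> \<bullet> z - \<phi> z\<close>; the tangent to \<open>\<psi>star\<close> at \<open>\<zeta>\<close>, whose slope is \<open>z\<close>,
  carries this over from \<open>\<xi>\<close> to \<open>\<zeta>\<close>.\<close>

lemma fenchel_equality_mirror:
  assumes A1: "mirror_assumption1 N X L mir \<psi>star" and A2: "mirror_assumption2 X mir \<psi>star \<phi>"
  shows "\<psi>star \<zeta> = \<zeta> \<bullet> mir \<zeta> - real_of_ereal (\<phi> (mir \<zeta>))"
proof -
  have proper: "ext_proper \<phi>" and conv: "ext_convex \<phi>" and XD: "X \<subseteq> ext_dom \<phi>"
    and cj: "\<And>\<zeta>. ereal (\<psi>star \<zeta>) = convex_conjugate (\<lambda>x. \<phi> x + indicator_fun X x) \<zeta>"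
    and diff: "ext_differentiable_at \<phi> (mir \<zeta>)"
    using A2 by (auto simp: mirror_assumption2_def)
  have z: "mir \<zeta> \<in> X"
    using A1 by (auto simp: mirror_assumption1_def)
  define \<xi> where "\<xi> = gradient (\<lambda>u. real_of_ereal (\<phi> u)) (mir \<zeta>)"
  have "\<psi>star \<xi> \<le> \<xi> \<bullet> mir \<zeta> - real_of_ereal (\<phi> (mir \<zeta>))"
  proof (rule conjugate_le[OF proper XD cj])
    fix u assume "u \<in> X"
    then show "\<xi> \<bullet> u - real_of_ereal (\<phi> u) \<le> \<xi> \<bullet> mir \<zeta> - real_of_ereal (\<phi> (mir \<zeta>))"
      using tangent_below_ext_convex[OF proper conv _ _ diff, of u] subsetD[OF XD z] subsetD[OF XD]
      by (simp add: \<xi>_def inner_diff_right)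
  qed
  moreover have "\<psi>star \<zeta> + mir \<zeta> \<bullet> (\<xi> - \<zeta>) \<le> \<psi>star \<xi>"
    using A1 by (intro tangent_below_convex_on[OF _ _ _ mirror_map_GDERIV[OF A1]])
      (auto simp: mirror_assumption1_def)
  ultimately have "\<psi>star \<zeta> \<le> \<zeta> \<bullet> mir \<zeta> - real_of_ereal (\<phi> (mir \<zeta>))"
    by (simp add: inner_diff_right inner_commute)
  then show ?thesis
    using conjugate_ge[OF proper z XD cj, of \<zeta>] by simp
qed

text \<open>Since \<open>mir \<zeta>\<close> maximizes \<open>\<lambda>u. \<zeta> \<bullet> u - \<phi> u\<close> over \<open>X\<close> and lies in the relative interior, \<open>\<zeta>\<close> and the
  gradient of \<open>\<phi>\<close> at \<open>mir \<zeta>\<close> agree on the directions of \<open>X\<close>, although they may differ as vectors. The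
  divergence thus becomes an expression in \<open>\<zeta>\<close> whose change under a step in \<open>\<zeta>\<close> is governed by
  \<open>\<psi>star\<close>.\<close>

lemma bregman_mirror:
  assumes A1: "mirror_assumption1 N X L mir \<psi>star" and A2: "mirror_assumption2 X mir \<psi>star \<phi>"
    and "convex X" and x: "x \<in> X"
  shows "bregman \<phi> x (mir \<zeta>) = real_of_ereal (\<phi> x) + \<psi>star \<zeta> - \<zeta> \<bullet> x"
proof -
  have proper: "ext_proper \<phi>" and XD: "X \<subseteq> ext_dom \<phi>"
    and cj: "ereal (\<psi>star \<zeta>) = convex_conjugate (\<lambda>x. \<phi> x + indicator_fun X x) \<zeta>"
    and diff: "ext_differentiable_at \<phi> (mir \<zeta>)" and ri: "mir \<zeta> \<in> rel_interior X"
    using A2 by (auto simp: mirror_assumption2_def)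
  let ?p = "\<lambda>u. real_of_ereal (\<phi> u)"
  have "GDERIV ?p (mir \<zeta>) :> gradient ?p (mir \<zeta>)"
    using diff by (intro GDERIV_gradient) (simp add: ext_differentiable_at_def)
  moreover have "GDERIV (\<lambda>u. \<zeta> \<bullet> u) (mir \<zeta>) :> \<zeta>"
    unfolding gderiv_def by (auto intro!: derivative_eq_intros simp: inner_commute)
  ultimately have D: "GDERIV (\<lambda>u. ?p u - \<zeta> \<bullet> u) (mir \<zeta>) :> gradient ?p (mir \<zeta>) - \<zeta>"
    by (rule GDERIV_diff)
  have "(gradient ?p (mir \<zeta>) - \<zeta>) \<bullet> (x - mir \<zeta>) = 0"
  proof (rule gradient_orthogonal_at_rel_interior_min[OF \<open>convex X\<close> ri x D])
    fix w assume "w \<in> X"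
    then show "?p (mir \<zeta>) - \<zeta> \<bullet> mir \<zeta> \<le> ?p w - \<zeta> \<bullet> w"
      using conjugate_ge[OF proper _ XD cj, of w] fenchel_equality_mirror[OF A1 A2, of \<zeta>] by simp
  qed
  then show ?thesis
    using fenchel_equality_mirror[OF A1 A2, of \<zeta>]
    by (simp add: bregman_def inner_diff_left inner_diff_right)
qed

lemma bregman_mirror_nonneg:
  assumes A1: "mirror_assumption1 N X L mir \<psi>star" and A2: "mirror_assumption2 X mir \<psi>star \<phi>"
    and "x \<in> X"
  shows "0 \<le> bregman \<phi> x (mir \<zeta>)"
proof -
  have "mir \<zeta> \<in> X"
    using A1 by (auto simp: mirror_assumption1_def)
  moreover have XD: "X \<subseteq> ext_dom \<phi>"
    using A2 by (simp add: mirror_assumption2_def)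
  ultimately have "mir \<zeta> \<in> ext_dom \<phi>" "x \<in> ext_dom \<phi>"
    using \<open>x \<in> X\<close> by blast+
  moreover have "ext_proper \<phi>" "ext_convex \<phi>" "ext_differentiable_at \<phi> (mir \<zeta>)"
    using A2 by (auto simp: mirror_assumption2_def)
  ultimately show ?thesis
    using tangent_below_ext_convex[of \<phi> "mir \<zeta>" x] by (simp add: bregman_def)
qed

text \<open>A step size \<open>0 < h \<le> 1 / (L\<^sub>f * L)\<close> only forces the two constants to have the same sign; this lemma
  rules out that both are negative.\<close>

lemma mirror_Lipschitz_nonneg:
  fixes N :: "real ^ 'n \<Rightarrow> real"
  assumes N: "is_norm N" and A1: "mirror_assumption1 N X L mir \<psi>star"
  shows "0 \<le> L"
proof -
  let ?e = "axis undefined 1 :: real ^ 'n"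
  have "0 \<le> N (mir ?e - mir 0)"
    using N by (simp add: is_norm_def)
  also have "\<dots> \<le> L * dual_norm N (?e - 0)"
    using A1 unfolding mirror_assumption1_def by blast
  finally have "0 \<le> L * dual_norm N ?e"
    by simp
  moreover have "?e \<noteq> 0"
    by (simp add: axis_eq_0_iff)
  then have "dual_norm N ?e > 0"
    by (rule dual_norm_pos[OF N])
  ultimately show ?thesis
    by (simp add: zero_le_mult_iff)
qed

text \<open>By the formula for the divergence in terms of \<open>\<zeta>\<close>, the linear term exceeds the change of the
  divergence by exactly the gap at \<open>\<zeta>\<close> between \<open>\<psi>star\<close> and its tangent at \<open>\<xi>\<close>. The quadratic lower bound
  on this gap is what pays for the smoothness error of \<open>f\<close>.\<close>

lemma bregman_mirror_step:
  assumes N: "is_norm N"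
    and A1: "mirror_assumption1 N X L mir \<psi>star" and A2: "mirror_assumption2 X mir \<psi>star \<phi>"
    and "convex X" and "x \<in> X" and "L > 0"
  shows "bregman \<phi> x (mir \<xi>) - bregman \<phi> x (mir \<zeta>)
    \<le> (\<xi> - \<zeta>) \<bullet> (mir \<xi> - x) - (N (mir \<xi> - mir \<zeta>))\<^sup>2 / (2 * L)"
proof -
  have "\<psi>star \<xi> + mir \<xi> \<bullet> (\<zeta> - \<xi>) + (N (mir \<zeta> - mir \<xi>))\<^sup>2 / (2 * L) \<le> \<psi>star \<zeta>"
    using A1 mirror_map_GDERIV[OF A1]
    by (intro convex_Lipschitz_gradient_lower_bound[OF N _ _ _ \<open>L > 0\<close>])
      (auto simp: mirror_assumption1_def)
  moreover have "N (mir \<zeta> - mir \<xi>) = N (mir \<xi> - mir \<zeta>)"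
    using N unfolding is_norm_def by (metis abs_1 abs_minus_cancel minus_diff_eq mult_1 scaleR_minus1_left)
  ultimately show ?thesis
    using bregman_mirror[OF A1 A2 \<open>convex X\<close> \<open>x \<in> X\<close>]
    by (simp add: inner_diff_left inner_diff_right inner_commute)
qed

section \<open>One step of accelerated mirror descent\<close>

lemma smooth_descent:
  assumes N: "is_norm N" and "convex X" and "X \<subseteq> U" and f: "convex_C1_on U f"
    and smooth: "smooth_wrt N L U f" and "a \<in> X" and "b \<in> X"
  shows "f b \<le> f a + gradient f a \<bullet> (b - a) + L * (N (b - a))\<^sup>2 / 2"
proof -
  have "f (a + (b - a)) \<le> f a + gradient f a \<bullet> (b - a) + L * (N (b - a))\<^sup>2 / 2"
  proof (rule descent_on_segment[where g = f and x = a and v = "b - a" and G = "gradient f"])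
    fix t :: real assume t: "0 \<le> t" "t \<le> 1"
    have "(1 - t) *\<^sub>R a + t *\<^sub>R b \<in> X"
      by (rule convexD_alt[OF \<open>convex X\<close> \<open>a \<in> X\<close> \<open>b \<in> X\<close> t])
    then have c: "a + t *\<^sub>R (b - a) \<in> U"
      using \<open>X \<subseteq> U\<close> by (auto simp: algebra_simps)
    show "GDERIV f (a + t *\<^sub>R (b - a)) :> gradient f (a + t *\<^sub>R (b - a))"
      using c f by (intro GDERIV_gradient) (auto simp: convex_C1_on_def)
    have "(gradient f (a + t *\<^sub>R (b - a)) - gradient f a) \<bullet> (b - a)
        \<le> dual_norm N (gradient f (a + t *\<^sub>R (b - a)) - gradient f a) * N (b - a)"
      by (rule inner_le_dual_norm[OF N])
    also have "\<dots> \<le> (L * N (a + t *\<^sub>R (b - a) - a)) * N (b - a)"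
    proof (rule mult_right_mono)
      show "dual_norm N (gradient f (a + t *\<^sub>R (b - a)) - gradient f a)
          \<le> L * N (a + t *\<^sub>R (b - a) - a)"
        using smooth c \<open>a \<in> X\<close> \<open>X \<subseteq> U\<close> unfolding smooth_wrt_def by blast
    qed (use N in \<open>simp add: is_norm_def\<close>)
    also have "\<dots> = t * (L * (N (b - a))\<^sup>2)"
      using N t by (simp add: is_norm_def power2_eq_square)
    finally show "(gradient f (a + t *\<^sub>R (b - a)) - gradient f a) \<bullet> (b - a)
        \<le> t * (L * (N (b - a))\<^sup>2)" .
  qed
  then show ?thesis
    by simp
qed

text \<open>Here \<open>c\<close> stands for \<open>\<gamma> k\<close>, \<open>z\<close> and \<open>z'\<close> for the consecutive mirror points and \<open>w\<close> for the minimizer.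
  The convexity inequality at \<open>x\<close> is taken with weight \<open>c\<^sup>2 - c\<close> and the one at \<open>w\<close> with weight \<open>c\<close>.
  With these weights \<open>x\<close> and \<open>y\<close> drop out of the linear terms, and what remains is the linear term of
  the divergence step.\<close>

lemma accelerated_function_decrease:
  assumes N: "is_norm N" and "convex X" and "X \<subseteq> U" and f: "convex_C1_on U f"
    and smooth: "smooth_wrt N L U f" and "c \<ge> 1"
    and inX: "x \<in> X" "y \<in> X" "x' \<in> X" "w \<in> X"
    and y: "y = x + (1 / c) *\<^sub>R (z - x)" and x': "x' = y + (1 / c) *\<^sub>R (z' - z)"
  shows "c\<^sup>2 * (f x' - f w) - (c\<^sup>2 - c) * (f x - f w)
    \<le> c * (gradient f y \<bullet> (z' - w)) + L * (N (z' - z))\<^sup>2 / 2"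
proof -
  let ?g = "gradient f y"
  have tangent: "f y + ?g \<bullet> (u - y) \<le> f u" if "u \<in> X" for u
    using f inX(2) that \<open>X \<subseteq> U\<close>
    by (intro tangent_below_convex_on[of U] GDERIV_gradient) (auto simp: convex_C1_on_def)
  have "c > 0"
    using \<open>c \<ge> 1\<close> by simp
  have step: "x' - y = (1 / c) *\<^sub>R (z' - z)"
    by (simp add: x')
  have "N (x' - y) = N (z' - z) / c"
    using N \<open>c > 0\<close> by (simp add: step is_norm_def)
  then have "f x' - f y \<le> (?g \<bullet> (z' - z)) / c + L * (N (z' - z) / c)\<^sup>2 / 2"
    using smooth_descent[OF N \<open>convex X\<close> \<open>X \<subseteq> U\<close> f smooth inX(2,3)] by (simp add: step)
  then have "c\<^sup>2 * (f x' - f y) \<le> c\<^sup>2 * ((?g \<bullet> (z' - z)) / c + L * (N (z' - z) / c)\<^sup>2 / 2)"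
    by (intro mult_left_mono) auto
  also have "\<dots> = c * (?g \<bullet> (z' - z)) + L * (N (z' - z))\<^sup>2 / 2"
    using \<open>c > 0\<close> by (simp add: power2_eq_square field_simps)
  finally have 1: "c\<^sup>2 * (f x' - f y) \<le> c * (?g \<bullet> (z' - z)) + L * (N (z' - z))\<^sup>2 / 2" .
  have "c\<^sup>2 - c \<ge> 0"
    using \<open>c \<ge> 1\<close> by (simp add: power2_eq_square)
  then have 2: "(c\<^sup>2 - c) * (?g \<bullet> (x - y)) \<le> (c\<^sup>2 - c) * (f x - f y)"
    using tangent[OF inX(1)] by (intro mult_left_mono) auto
  have 3: "c * (?g \<bullet> (w - y)) \<le> c * (f w - f y)"
    using tangent[OF inX(4)] \<open>c > 0\<close> by (intro mult_left_mono) auto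
  have "c *\<^sub>R y = c *\<^sub>R x + (z - x)"
    using \<open>c > 0\<close> by (simp add: y scaleR_add_right)
  then have "(c - 1) *\<^sub>R (x - y) = y - z"
    by (simp add: algebra_simps)
  then have "(c - 1) * (?g \<bullet> (x - y)) = ?g \<bullet> (y - z)"
    by (metis inner_scaleR_right)
  moreover have "(c\<^sup>2 - c) * (?g \<bullet> (x - y)) = c * ((c - 1) * (?g \<bullet> (x - y)))"
    by (simp add: power2_eq_square algebra_simps)
  ultimately have "(c\<^sup>2 - c) * (?g \<bullet> (x - y)) = c * (?g \<bullet> (y - z))"
    by simp
  with 1 2 3 show ?thesis
    by (simp add: algebra_simps)
qed

theorem theorem5:
  fixes N :: "real ^ 'n \<Rightarrow> real"
    and X U :: "(real ^ 'n) set"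
    and f \<psi>star :: "real ^ 'n \<Rightarrow> real"
    and \<phi> :: "real ^ 'n \<Rightarrow> ereal"
    and mir :: "real ^ 'n \<Rightarrow> real ^ 'n"
    and \<gamma> :: "nat \<Rightarrow> real"
    and h L\<^sub>f L\<^sub>m :: real
    and x y \<zeta> :: "nat \<Rightarrow> real ^ 'n"
    and xstar :: "real ^ 'n"
  assumes "is_norm N"
    and "X \<noteq> {}" and "closed X" and "convex X"
    and "open U" and "X \<subseteq> U" and "convex_C1_on U f"
    and "mirror_assumption1 N X L\<^sub>m mir \<psi>star"
    and "mirror_assumption2 X mir \<psi>star \<phi>"
    and "\<gamma> 0 = 1" and "\<forall>k. \<gamma> k \<ge> 1"
    and "\<forall>k\<ge>1. (\<gamma> k)\<^sup>2 - (\<gamma> (k - 1))\<^sup>2 - \<gamma> k \<le> 0"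
    and "smooth_wrt N L\<^sub>f U f"
    and "h > 0" and "h \<le> 1 / (L\<^sub>f * L\<^sub>m)"
    and "xstar \<in> X" and "\<forall>u\<in>X. f xstar \<le> f u"
    and "amd X f mir \<gamma> h x y \<zeta>"
  shows "(\<forall>k. Vhat f \<phi> mir \<gamma> h xstar (Suc k) (x (Suc k)) (\<zeta> (Suc k))
              \<le> Vhat f \<phi> mir \<gamma> h xstar k (x k) (\<zeta> k)) \<and>
         (\<forall>k. ((\<gamma> k)\<^sup>2 - \<gamma> k) * h * (f (x k) - f xstar) \<le> bregman \<phi> xstar (mir (\<zeta> 0)))"
proof -
  note N = \<open>is_norm N\<close> and A1 = \<open>mirror_assumption1 N X L\<^sub>m mir \<psi>star\<close>
    and A2 = \<open>mirror_assumption2 X mir \<psi>star \<phi>\<close>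
  have y: "y k = x k + (1 / \<gamma> k) *\<^sub>R (mir (\<zeta> k) - x k)"
    and \<zeta>: "\<zeta> (Suc k) = \<zeta> k - (\<gamma> k * h) *\<^sub>R gradient f (y k)"
    and x: "x (Suc k) = y k + (1 / \<gamma> k) *\<^sub>R (mir (\<zeta> (Suc k)) - mir (\<zeta> k))" for k
    using \<open>amd X f mir \<gamma> h x y \<zeta>\<close> by (auto simp: amd_def)
  have \<gamma>: "\<gamma> k \<ge> 1" for k
    using \<open>\<forall>k. \<gamma> k \<ge> 1\<close> by blast
  have mirX: "mir \<xi> \<in> X" for \<xi>
    using A1 by (auto simp: mirror_assumption1_def)
  \<comment> \<open>Since \<open>1 / 0 = 0\<close>, the bound on \<open>h\<close> excludes a vanishing product of the constants as well as a
    negative one.\<close>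
  have "0 < 1 / (L\<^sub>f * L\<^sub>m)"
    using \<open>h > 0\<close> \<open>h \<le> 1 / (L\<^sub>f * L\<^sub>m)\<close> by (rule less_le_trans)
  then have "L\<^sub>f * L\<^sub>m > 0"
    by simp
  with mirror_Lipschitz_nonneg[OF N A1] have L: "L\<^sub>m > 0" "L\<^sub>f > 0"
    by (auto simp: zero_less_mult_iff)
  then have hL: "h * L\<^sub>f \<le> 1 / L\<^sub>m"
    using \<open>h \<le> 1 / (L\<^sub>f * L\<^sub>m)\<close> by (simp add: field_simps)
  \<comment> \<open>Both \<open>y k\<close> and \<open>x (Suc k)\<close> are averages, with weight \<open>1 / \<gamma> k\<close>, of \<open>x k\<close> and a mirror point.\<close>
  have avg: "x k + (1 / \<gamma> k) *\<^sub>R (u - x k) \<in> X" if "x k \<in> X" "u \<in> X" for k u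
  proof -
    have "(1 - 1 / \<gamma> k) *\<^sub>R x k + (1 / \<gamma> k) *\<^sub>R u \<in> X"
      using \<gamma>[of k] that by (intro convexD_alt[OF \<open>convex X\<close>]) auto
    then show ?thesis
      by (simp add: algebra_simps)
  qed
  have x': "x (Suc k) = x k + (1 / \<gamma> k) *\<^sub>R (mir (\<zeta> (Suc k)) - x k)" for k
    by (simp add: x y algebra_simps)
  have xX: "x k \<in> X" for k
  proof (induction k)
    case 0
    then show ?case
      using \<open>amd X f mir \<gamma> h x y \<zeta>\<close> by (simp add: amd_def)
  next
    case (Suc k)
    then show ?case
      unfolding x' by (intro avg mirX)
  qed
  have yX: "y k \<in> X" for k
    unfolding y by (intro avg xX mirX)
  have step: "Vhat f \<phi> mir \<gamma> h xstar (Suc k) (x (Suc k)) (\<zeta> (Suc k))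
      \<le> Vhat f \<phi> mir \<gamma> h xstar k (x k) (\<zeta> k)" for k
  proof -
    define n where "n = N (mir (\<zeta> (Suc k)) - mir (\<zeta> k))"
    define l where "l = \<gamma> k * (gradient f (y k) \<bullet> (mir (\<zeta> (Suc k)) - xstar))"
    have "(\<gamma> (Suc k))\<^sup>2 - \<gamma> (Suc k) \<le> (\<gamma> k)\<^sup>2"
      using \<open>\<forall>k\<ge>1. (\<gamma> k)\<^sup>2 - (\<gamma> (k - 1))\<^sup>2 - \<gamma> k \<le> 0\<close>[rule_format, of "Suc k"] by simp
    moreover have "0 \<le> h * (f (x (Suc k)) - f xstar)"
      using \<open>h > 0\<close> \<open>\<forall>u\<in>X. f xstar \<le> f u\<close> xX by simp
    ultimately have 1: "((\<gamma> (Suc k))\<^sup>2 - \<gamma> (Suc k)) * (h * (f (x (Suc k)) - f xstar))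
        \<le> (\<gamma> k)\<^sup>2 * (h * (f (x (Suc k)) - f xstar))"
      by (rule mult_right_mono)
    have "(\<gamma> k)\<^sup>2 * (f (x (Suc k)) - f xstar) - ((\<gamma> k)\<^sup>2 - \<gamma> k) * (f (x k) - f xstar)
        \<le> l + L\<^sub>f * n\<^sup>2 / 2"
      unfolding l_def n_def
      by (rule accelerated_function_decrease[OF N \<open>convex X\<close> \<open>X \<subseteq> U\<close> \<open>convex_C1_on U f\<close>
            \<open>smooth_wrt N L\<^sub>f U f\<close> \<gamma> xX yX xX \<open>xstar \<in> X\<close> y x])
    then have 2: "h * ((\<gamma> k)\<^sup>2 * (f (x (Suc k)) - f xstar) - ((\<gamma> k)\<^sup>2 - \<gamma> k) * (f (x k) - f xstar))
        \<le> h * (l + L\<^sub>f * n\<^sup>2 / 2)"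
      using \<open>h > 0\<close> by (intro mult_left_mono) auto
    have "bregman \<phi> xstar (mir (\<zeta> (Suc k))) - bregman \<phi> xstar (mir (\<zeta> k))
        \<le> (\<zeta> (Suc k) - \<zeta> k) \<bullet> (mir (\<zeta> (Suc k)) - xstar) - n\<^sup>2 / (2 * L\<^sub>m)"
      unfolding n_def by (rule bregman_mirror_step[OF N A1 A2 \<open>convex X\<close> \<open>xstar \<in> X\<close> L(1)])
    also have "(\<zeta> (Suc k) - \<zeta> k) \<bullet> (mir (\<zeta> (Suc k)) - xstar) = - h * l"
      by (simp add: \<zeta> l_def)
    finally have 3: "bregman \<phi> xstar (mir (\<zeta> (Suc k))) - bregman \<phi> xstar (mir (\<zeta> k))
        \<le> - h * l - n\<^sup>2 / (2 * L\<^sub>m)" .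
    have "h * L\<^sub>f * n\<^sup>2 \<le> 1 / L\<^sub>m * n\<^sup>2"
      using hL by (rule mult_right_mono) simp
    then have 4: "h * (L\<^sub>f * n\<^sup>2 / 2) \<le> n\<^sup>2 / (2 * L\<^sub>m)"
      by simp
    from 1 2 3 4 show ?thesis
      unfolding Vhat_def by (simp add: algebra_simps)
  qed
  have "Vhat f \<phi> mir \<gamma> h xstar k (x k) (\<zeta> k) \<le> Vhat f \<phi> mir \<gamma> h xstar 0 (x 0) (\<zeta> 0)" for k
    using lift_Suc_antimono_le[of "\<lambda>k. Vhat f \<phi> mir \<gamma> h xstar k (x k) (\<zeta> k)", OF step, of 0 k] by simp
  moreover have "Vhat f \<phi> mir \<gamma> h xstar 0 (x 0) (\<zeta> 0) = bregman \<phi> xstar (mir (\<zeta> 0))"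
    using \<open>\<gamma> 0 = 1\<close> by (simp add: Vhat_def)
  moreover have "((\<gamma> k)\<^sup>2 - \<gamma> k) * h * (f (x k) - f xstar)
      \<le> Vhat f \<phi> mir \<gamma> h xstar k (x k) (\<zeta> k)" for k
    using bregman_mirror_nonneg[OF A1 A2 \<open>xstar \<in> X\<close>] by (simp add: Vhat_def)
  ultimately have "((\<gamma> k)\<^sup>2 - \<gamma> k) * h * (f (x k) - f xstar) \<le> bregman \<phi> xstar (mir (\<zeta> 0))" for k
    by (metis order_trans)
  with step show ?thesis
    by blast
qed

end
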